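(* Let $X\subset\mathbb{R}^n$ be a finite set, let $f\colon X\to\{-1,1\}$ and $F\colon\{-1,1\}^k\to\{-1,1\}$ be given functions. Then \[\deg_{\pm}(F(f,\dots,f))\geq \deg_{\pm}(F)\,\deg_{\pm}(f).\]
   Context: Boolean functions take values in $\{-1,1\}$. For a function $h\colon Z\to\{-1,1\}$ on a finite set $Z\subset\mathbb{R}^m$, the threshold degree $\deg_{\pm}(h)$ is the least (total) degree of a real polynomial $p$ with $h(z)p(z)>0$ for all $z\in Z$. The composition $F(f,\dots,f)$ is the function on $X^k$ given by $(x_1,\dots,x_k)\mapsto F(f(x_1),\dots,f(x_k))$, viewed as a function on a finite subset of $\mathbb{R}^{nk}$. *)

theory Defs
  imports "HOL-Analysis.Analysis" "HOL-Library.Poly_Mapping"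
begin

text \<open>
  Real polynomials in variables indexed by \<open>'v\<close>: a monomial is a finitely supported exponent
  vector \<open>'v \<Rightarrow>\<^sub>0 nat\<close>, and a polynomial is a finitely supported family of real coefficients
  indexed by monomials.
\<close>

type_synonym 'v rpoly = "('v \<Rightarrow>\<^sub>0 nat) \<Rightarrow>\<^sub>0 real"

definition rpoly_eval :: "('v::finite) rpoly \<Rightarrow> real ^ 'v \<Rightarrow> real" where
  "rpoly_eval p x =
     (\<Sum>m\<in>Poly_Mapping.keys p. Poly_Mapping.lookup p m * (\<Prod>v\<in>UNIV. x $ v ^ Poly_Mapping.lookup m v))"

definition monomial_degree :: "(('v::finite) \<Rightarrow>\<^sub>0 nat) \<Rightarrow> nat" where
  "monomial_degree m = (\<Sum>v\<in>UNIV. Poly_Mapping.lookup m v)"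

text \<open>The zero polynomial is given total degree \<open>0\<close>.\<close>

definition total_degree :: "('v::finite) rpoly \<Rightarrow> nat" where
  "total_degree p = Max (insert 0 (monomial_degree ` Poly_Mapping.keys p))"

text \<open>
  Only the values of \<open>h\<close> on \<open>Z\<close> matter. For finite \<open>Z\<close> and \<open>h\<close> nonzero on \<open>Z\<close>, interpolation
  shows that the minimum is over a nonempty set of degrees.
\<close>

definition threshold_degree :: "(real ^ 'v::finite) set \<Rightarrow> (real ^ 'v \<Rightarrow> real) \<Rightarrow> nat" where
  "threshold_degree Z h =
     (LEAST d. \<exists>p. total_degree p = d \<and> (\<forall>z\<in>Z. h z * rpoly_eval p z > 0))"

definition sign_cube :: "(real ^ 'k::finite) set" where
  "sign_cube = {y. \<forall>i. y $ i \<in> {-1, 1}}"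

text \<open>
  With \<open>n\<close> and \<open>k\<close> the cardinalities of \<open>'n\<close> and \<open>'k\<close>, a point of real \<open>nk\<close>-space is a vector
  indexed by \<open>'k \<times> 'n\<close>, i.e. the concatenation of its \<open>k\<close> blocks in \<open>n\<close>-space.
\<close>

definition block :: "real ^ ('k::finite \<times> 'n::finite) \<Rightarrow> 'k \<Rightarrow> real ^ 'n" where
  "block z i = (\<chi> j. z $ (i, j))"

definition block_power :: "(real ^ 'n::finite) set \<Rightarrow> (real ^ ('k::finite \<times> 'n)) set" where
  "block_power X = {z. \<forall>i. block z i \<in> X}"

definition block_compose ::
    "(real ^ 'k::finite \<Rightarrow> real) \<Rightarrow> (real ^ 'n::finite \<Rightarrow> real) \<Rightarrow> real ^ ('k \<times> 'n) \<Rightarrow> real" where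
  "block_compose F f z = F (\<chi> i. f (block z i))"

end

theory Submission
  imports Defs
begin

text \<open>
  Let \<open>d\<close> be the threshold degree of \<open>f\<close>. By Gordan's alternative there are weights \<open>\<mu> \<ge> 0\<close> on
  \<open>X\<close>, not all zero, such that \<open>f \<mu>\<close> is orthogonal to all polynomials of degree less than \<open>d\<close>.
  Let \<open>p\<close> sign-represent the composition, and average \<open>p\<close> over \<open>X\<^sup>k\<close> with the weights
  \<open>\<Prod>i. \<mu> x\<^sub>i (1 + y\<^sub>i f x\<^sub>i)\<close>. For \<open>y\<close> in the sign cube, these are nonnegative and supported where
  \<open>f x\<^sub>i = y\<^sub>i\<close> for all \<open>i\<close>, so the average \<open>P y\<close> has the sign of \<open>F y\<close>. A monomial of \<open>p\<close> is a
  product of monomials \<open>m\<^sub>i x\<^sub>i\<close> and contributes the product of the affine functions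
  \<open>(\<Sum>x. \<mu> x m\<^sub>i x) + y\<^sub>i (\<Sum>x. \<mu> x f x m\<^sub>i x)\<close>, which is constant unless \<open>deg m\<^sub>i \<ge> d\<close>. Hence
  \<open>d deg P \<le> deg p\<close>.
\<close>

section \<open>Gordan's alternative\<close>

text \<open>A finite set puts only finitely many positive upper bounds on the size of the
  perturbation, so the induction shrinks \<open>e\<close> once for each point.\<close>

lemma finite_positive_perturbation:
  fixes g h :: "'a \<Rightarrow> real"
  assumes "finite Y" and "\<And>x. x \<in> Y \<Longrightarrow> g x > 0"
  shows "\<exists>e>0. \<forall>x\<in>Y. g x + e * h x > 0"
  using assms
proof (induction Y rule: finite_induct)
  case empty
  show ?case by (rule exI[of _ 1]) simp
next
  case (insert a Y)
  then obtain e where e: "e > 0" "\<forall>x\<in>Y. g x + e * h x > 0" by auto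
  have ga: "g a > 0" using insert.prems by simp
  \<comment> \<open>The \<open>+ 1\<close> avoids division by zero and makes the bound strict:
    \<open>e' * \<bar>h a\<bar> \<le> g a - e' < g a\<close>.\<close>
  define e' where "e' = min e (g a / (\<bar>h a\<bar> + 1))"
  have e': "e' > 0" "e' \<le> e" using e ga by (auto simp: e'_def)
  have "g x + e' * h x > 0" if x: "x \<in> Y" for x
  proof (cases "h x \<ge> 0")
    case True
    then show ?thesis using e' insert.prems x by (simp add: add_pos_nonneg)
  next
    case False
    then have "e' * h x \<ge> e * h x" using e' by (intro mult_right_mono_neg) auto
    then show ?thesis using e x by fastforce
  qed
  moreover have "g a + e' * h a > 0"
  proof -
    have "e' * (\<bar>h a\<bar> + 1) \<le> g a"
      using pos_le_divide_eq[of "\<bar>h a\<bar> + 1" e' "g a"] by (simp add: e'_def)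
    moreover have "e' * (- h a) \<le> e' * \<bar>h a\<bar>" using e' by (intro mult_left_mono) auto
    ultimately show ?thesis using e' by (simp add: algebra_simps)
  qed
  ultimately show ?case using e' by blast
qed

text \<open>The two hypotheses on \<open>V\<close> make it a linear space of functions. The
  induction removes one point \<open>a\<close> of \<open>X\<close>; \<open>V\<close> stays arbitrary
  because the induction hypothesis is applied both to \<open>V\<close> and to its subspace of
  functions vanishing at \<open>a\<close>.\<close>

lemma gordan_alternative:
  fixes V :: "('a \<Rightarrow> real) set"
  assumes "finite X"
    and "(\<lambda>_. 0) \<in> V"
    and "\<And>g h c. g \<in> V \<Longrightarrow> h \<in> V \<Longrightarrow> (\<lambda>x. g x + c * h x) \<in> V"
  shows "(\<exists>g\<in>V. \<forall>x\<in>X. g x > 0) \<or>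
         (\<exists>\<mu>. (\<forall>x\<in>X. \<mu> x \<ge> 0) \<and> (\<exists>x\<in>X. \<mu> x > 0) \<and> (\<forall>g\<in>V. (\<Sum>x\<in>X. \<mu> x * g x) = 0))"
  using assms
proof (induction X arbitrary: V rule: finite_induct)
  case empty
  then show ?case by auto
next
  case (insert a Y)
  note zero = insert.prems(1) and lin = insert.prems(2)
  let ?dual = "\<lambda>X V \<mu>. (\<forall>x\<in>X. \<mu> x \<ge> 0) \<and> (\<exists>x\<in>X. \<mu> x > 0) \<and> (\<forall>g\<in>V. (\<Sum>x\<in>X. \<mu> x * g x) = (0::real))"
  have extend: "(\<Sum>x\<in>insert a Y. (\<mu>(a := t)) x * g x) = t * g a + (\<Sum>x\<in>Y. \<mu> x * g x)"
    for \<mu> g :: "'a \<Rightarrow> real" and t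
  proof -
    have "(\<Sum>x\<in>Y. (\<mu>(a := t)) x * g x) = (\<Sum>x\<in>Y. \<mu> x * g x)"
      using insert.hyps by (intro sum.cong) auto
    then show ?thesis using insert.hyps by simp
  qed
  have ext_dual: "?dual (insert a Y) V (\<mu>(a := t))"
    if "\<forall>x\<in>Y. \<mu> x \<ge> 0" "t \<ge> 0" "\<exists>x\<in>Y. \<mu> x > 0" 
       "\<And>g. g \<in> V \<Longrightarrow> t * g a + (\<Sum>x\<in>Y. \<mu> x * g x) = 0" for \<mu> t
    using that insert.hyps extend by auto
  show ?case
  proof (cases "\<forall>h\<in>V. h a = 0")
    case True
    \<comment> \<open>The point mass at \<open>a\<close> annihilates \<open>V\<close>.\<close>
    have "?dual (insert a Y) V ((\<lambda>_. 0)(a := 1))"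
      using True extend[of "\<lambda>_. 0" 1] by auto
    then show ?thesis by blast
  next
    case False
    then obtain h0 where h0: "h0 \<in> V" "h0 a \<noteq> 0" by blast
    define h where "h = (\<lambda>x. 0 + (1 / h0 a) * h0 x)"
    have h: "h \<in> V" unfolding h_def by (rule lin[OF zero h0(1)])
    have ha: "h a = 1" using h0(2) by (simp add: h_def)
    \<comment> \<open>A function in \<open>V'\<close> that is positive on \<open>Y\<close> is zero
      at \<open>a\<close>, so adding a small multiple of \<open>h\<close>, where
      \<open>h a = 1\<close>, makes it positive everywhere. Otherwise there are weights on
      \<open>Y\<close> annihilating \<open>V'\<close>.\<close>
    define V' where "V' = {g \<in> V. g a = 0}"
    have "(\<exists>g\<in>V'. \<forall>x\<in>Y. g x > 0) \<or> (\<exists>\<mu>. ?dual Y V' \<mu>)"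
      using lin zero by (intro insert.IH) (auto simp: V'_def)
    then show ?thesis
    proof (elim disjE bexE exE)
      fix g assume g: "g \<in> V'" "\<forall>x\<in>Y. g x > 0"
      obtain e where e: "e > 0" "\<forall>x\<in>Y. g x + e * h x > 0"
        using finite_positive_perturbation[of Y g h] insert.hyps g by auto
      have "(\<lambda>x. g x + e * h x) \<in> V" using lin g h by (auto simp: V'_def)
      moreover have "\<forall>x\<in>insert a Y. g x + e * h x > 0" using e g ha by (auto simp: V'_def)
      ultimately show ?thesis by (intro disjI1) (rule bexI[rotated])
    next
      fix \<mu> assume \<mu>: "?dual Y V' \<mu>"
      define s where "s = (\<Sum>x\<in>Y. \<mu> x * h x)"
      \<comment> \<open>Subtracting \<open>g a * h\<close> moves \<open>g\<close> into
        \<open>V'\<close>. On all of \<open>V\<close> the weights therefore act as \<open>s\<close>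
        times evaluation at \<open>a\<close>.\<close>
      have *: "(\<Sum>x\<in>Y. \<mu> x * g x) = g a * s" if g: "g \<in> V" for g
      proof -
        have "\<forall>g\<in>V'. (\<Sum>x\<in>Y. \<mu> x * g x) = 0" using \<mu> by simp
        moreover have "(\<lambda>x. g x + (- g a) * h x) \<in> V'"
          using lin[OF g h, of "- g a"] ha by (simp add: V'_def)
        ultimately have "(\<Sum>x\<in>Y. \<mu> x * (g x + (- g a) * h x)) = 0" by (rule bspec)
        then show ?thesis
          by (simp add: s_def algebra_simps sum.distrib sum_subtractf sum_distrib_left)
      qed
      show ?thesis
      proof (cases "s \<le> 0")
        case True
        \<comment> \<open>The weight \<open>- s\<close> at \<open>a\<close> is nonnegative and
          cancels \<open>g a * s\<close>.\<close>
        then have "?dual (insert a Y) V (\<mu>(a := - s))"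
          using \<mu> * by (intro ext_dual) auto
        then show ?thesis by blast
      next
        case s: False
        \<comment> \<open>Now \<open>s > 0\<close>, so any \<open>g\<close> in \<open>V\<close> that
          is positive on \<open>Y\<close> satisfies \<open>g a * s > 0\<close> and is positive at
          \<open>a\<close> too. Weights annihilating \<open>V\<close> on \<open>Y\<close> extend by
          zero.\<close>
        have "(\<exists>g\<in>V. \<forall>x\<in>Y. g x > 0) \<or> (\<exists>\<mu>. ?dual Y V \<mu>)"
          using lin zero by (intro insert.IH) auto
        then show ?thesis
        proof (elim disjE bexE exE)
          fix g assume g: "g \<in> V" "\<forall>x\<in>Y. g x > 0"
          obtain y where y: "y \<in> Y" "\<mu> y > 0" using \<mu> by blast
          have "(\<Sum>x\<in>Y. \<mu> x * g x) > 0"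
            using insert.hyps(1) y \<mu> g
            by (intro sum_pos2[of _ y]) (auto simp: less_imp_le)
          then have "g a > 0" using *[OF g(1)] s by (simp add: zero_less_mult_iff)
          then show ?thesis using g by auto
        next
          fix \<nu> assume "?dual Y V \<nu>"
          then have "?dual (insert a Y) V (\<nu>(a := 0))" by (intro ext_dual) auto
          then show ?thesis by blast
        qed
      qed
    qed
  qed
qed

section \<open>Polynomial functions of bounded degree\<close>

definition monomial_eval :: "('v::finite \<Rightarrow>\<^sub>0 nat) \<Rightarrow> real ^ 'v \<Rightarrow> real" where
  "monomial_eval m x = (\<Prod>v\<in>UNIV. x $ v ^ Poly_Mapping.lookup m v)"

text \<open>Only values of polynomials matter for sign representation. Bounding the degree instead
  of fixing it yields a linear space, as Gordan's alternative requires.\<close>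

definition polyfun_le :: "nat \<Rightarrow> (real ^ 'v::finite \<Rightarrow> real) set" where
  "polyfun_le d = {rpoly_eval p | p. total_degree p \<le> d}"

lemma total_degree_le_iff:
  "total_degree p \<le> d \<longleftrightarrow> (\<forall>m\<in>Poly_Mapping.keys p. monomial_degree m \<le> d)"
  by (simp add: total_degree_def)

lemma rpoly_eval_superset:
  assumes "finite A" "Poly_Mapping.keys p \<subseteq> A"
  shows "rpoly_eval p x = (\<Sum>m\<in>A. Poly_Mapping.lookup p m * monomial_eval m x)"
  unfolding rpoly_eval_def monomial_eval_def[symmetric]
  using assms by (intro sum.mono_neutral_left) (auto simp: in_keys_iff)

lemma rpoly_eval_add: "rpoly_eval (p + q) x = rpoly_eval p x + rpoly_eval q x"
proof -
  let ?A = "Poly_Mapping.keys p \<union> Poly_Mapping.keys q"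
  show ?thesis
    using Poly_Mapping.keys_add[of p q]
    by (simp add: rpoly_eval_superset[of ?A] lookup_add algebra_simps sum.distrib)
qed

lemma rpoly_eval_single: "rpoly_eval (Poly_Mapping.single m c) x = c * monomial_eval m x"
  by (simp add: rpoly_eval_superset[of "{m}"])

lemma polyfun_le_monomial:
  assumes "monomial_degree m \<le> d"
  shows "(\<lambda>x. c * monomial_eval m x) \<in> polyfun_le d"
proof -
  have "(\<lambda>x. c * monomial_eval m x) = rpoly_eval (Poly_Mapping.single m c)"
    by (simp add: rpoly_eval_single fun_eq_iff)
  then show ?thesis
    using assms
    by (auto simp: polyfun_le_def total_degree_le_iff split: if_splits
        intro!: exI[of _ "Poly_Mapping.single m c"])
qed

lemma polyfun_le_add:
  assumes "g \<in> polyfun_le d" "h \<in> polyfun_le d"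
  shows "(\<lambda>x. g x + h x) \<in> polyfun_le d"
proof -
  obtain p q where "g = rpoly_eval p" "h = rpoly_eval q" "total_degree p \<le> d" "total_degree q \<le> d"
    using assms by (auto simp: polyfun_le_def)
  moreover have "total_degree (p + q) \<le> d" if "total_degree p \<le> d" "total_degree q \<le> d"
    using that Poly_Mapping.keys_add[of p q] by (auto simp: total_degree_le_iff)
  ultimately show ?thesis
    unfolding polyfun_le_def by (auto simp: rpoly_eval_add fun_eq_iff intro!: exI[of _ "p + q"])
qed

lemma polyfun_le_mono: "d \<le> e \<Longrightarrow> polyfun_le d \<subseteq> polyfun_le e"
  by (auto simp: polyfun_le_def)

lemma monomial_eval_0: "monomial_eval 0 x = 1"
  by (simp add: monomial_eval_def)

lemma polyfun_le_const: "(\<lambda>_. c) \<in> polyfun_le d"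
  using polyfun_le_monomial[of 0 d c] by (simp add: monomial_degree_def monomial_eval_0)

lemma polyfun_le_sum:
  assumes "\<And>i. i \<in> I \<Longrightarrow> g i \<in> polyfun_le d"
  shows "(\<lambda>x. \<Sum>i\<in>I. g i x) \<in> polyfun_le d"
  using assms
  by (induction I rule: infinite_finite_induct) (auto intro: polyfun_le_const polyfun_le_add)

lemma polyfun_le_mult:
  assumes "g \<in> polyfun_le d" "h \<in> polyfun_le e"
  shows "(\<lambda>x. g x * h x) \<in> polyfun_le (d + e)"
proof -
  obtain p q where pq: "g = rpoly_eval p" "h = rpoly_eval q" "total_degree p \<le> d" "total_degree q \<le> e"
    using assms by (auto simp: polyfun_le_def)
  have "(\<lambda>x. g x * h x) = (\<lambda>x. \<Sum>m\<in>Poly_Mapping.keys p. \<Sum>m'\<in>Poly_Mapping.keys q.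
      (Poly_Mapping.lookup p m * Poly_Mapping.lookup q m') * monomial_eval (m + m') x)"
    by (simp add: pq rpoly_eval_def sum_product monomial_eval_def lookup_add power_add
        prod.distrib algebra_simps)
  also have "\<dots> \<in> polyfun_le (d + e)"
    using pq(3,4)
    by (intro polyfun_le_sum polyfun_le_monomial)
       (auto simp: total_degree_le_iff monomial_degree_def lookup_add sum.distrib intro!: add_mono)
  finally show ?thesis .
qed

lemma polyfun_le_cmult: "g \<in> polyfun_le d \<Longrightarrow> (\<lambda>x. c * g x) \<in> polyfun_le d"
  using polyfun_le_mult[OF polyfun_le_const[of c 0]] by simp

lemma polyfun_le_prod:
  assumes "\<And>i. i \<in> I \<Longrightarrow> g i \<in> polyfun_le (e i)"
  shows "(\<lambda>x. \<Prod>i\<in>I. g i x) \<in> polyfun_le (\<Sum>i\<in>I. e i)"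
  using assms
  by (induction I rule: infinite_finite_induct) (auto intro: polyfun_le_const polyfun_le_mult)

lemma polyfun_le_component: "(\<lambda>x. x $ v) \<in> polyfun_le 1"
proof -
  have "monomial_eval (Poly_Mapping.single v 1) x = x $ v" for x :: "real ^ 'a"
  proof -
    have "monomial_eval (Poly_Mapping.single v 1) x = (\<Prod>w\<in>UNIV. if w = v then x $ w else 1)"
      unfolding monomial_eval_def by (intro prod.cong) (auto simp: lookup_single when_def)
    then show ?thesis by simp
  qed
  moreover have "monomial_degree (Poly_Mapping.single v 1) \<le> 1"
    by (simp add: monomial_degree_def lookup_single when_def)
  ultimately show ?thesis using polyfun_le_monomial[of "Poly_Mapping.single v 1" 1 1] by simp
qed

text \<open>Lagrange interpolation in several variables. The degree is irrelevant: the result serves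
  only to show that some sign-representing polynomial exists.\<close>

lemma polyfun_le_interpolation:
  fixes Z :: "(real ^ 'v::finite) set"
  assumes "finite Z"
  shows "\<exists>d. \<exists>g\<in>polyfun_le d. \<forall>z\<in>Z. g z = h z"
proof -
  \<comment> \<open>The product of the squared distances from \<open>x\<close> to the points of
    \<open>Z\<close> other than \<open>z\<close>; it vanishes at those points and not at
    \<open>z\<close>.\<close>
  define L where "L z x = (\<Prod>w\<in>Z - {z}. \<Sum>v\<in>UNIV. (x $ v + - (w $ v)) * (x $ v + - (w $ v)))"
    for z x :: "real ^ 'v"
  have lin: "(\<lambda>x. x $ v + - (w $ v)) \<in> polyfun_le 1" for v and w :: "real ^ 'v"
    by (intro polyfun_le_add polyfun_le_component polyfun_le_const)
  have L: "L z \<in> polyfun_le (\<Sum>w\<in>Z - {z}. 1 + 1)" for z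
    unfolding L_def by (intro polyfun_le_prod polyfun_le_sum polyfun_le_mult lin)
  have "(\<Sum>w\<in>Z - {z}. 1 + 1) \<le> 2 * card Z" for z
    using card_Diff1_le[of Z z] by simp
  then have L': "L z \<in> polyfun_le (2 * card Z)" for z
    using L polyfun_le_mono by blast
  have L0: "L z w = 0" if "w \<in> Z" "w \<noteq> z" for z w
    unfolding L_def using that assms by (intro prod_zero bexI[of _ w]) auto
  have L1: "L z z \<noteq> 0" for z
    unfolding L_def using assms by (auto simp: sum_nonneg_eq_0_iff vec_eq_iff)
  define g where "g x = (\<Sum>z\<in>Z. (h z / L z z) * L z x)" for x
  have "g \<in> polyfun_le (2 * card Z)"
    unfolding g_def by (intro polyfun_le_sum polyfun_le_cmult L')
  moreover have "g w = h w" if "w \<in> Z" for w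
  proof -
    have "g w = (\<Sum>z\<in>Z. if z = w then h w else 0)"
      unfolding g_def using L0 L1 that by (intro sum.cong) auto
    then show ?thesis using assms that by simp
  qed
  ultimately show ?thesis by blast
qed

section \<open>Threshold degree\<close>

lemma threshold_degree_le:
  assumes "g \<in> polyfun_le d" "\<And>z. z \<in> Z \<Longrightarrow> h z * g z > 0"
  shows "threshold_degree Z h \<le> d"
proof -
  obtain p where p: "g = rpoly_eval p" "total_degree p \<le> d"
    using assms(1) by (auto simp: polyfun_le_def)
  have "threshold_degree Z h \<le> total_degree p"
    unfolding threshold_degree_def using assms(2) p by (intro Least_le) blast
  then show ?thesis using p by simp
qed

text \<open>\<open>LEAST\<close> is informative only over a nonempty set. A polynomial interpolating
  \<open>h\<close> itself is a member, since \<open>h z * h z > 0\<close>.\<close>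

lemma threshold_degree_attained:
  assumes "finite Z" "\<And>z. z \<in> Z \<Longrightarrow> h z \<noteq> 0"
  obtains p where "total_degree p = threshold_degree Z h"
    "\<And>z. z \<in> Z \<Longrightarrow> h z * rpoly_eval p z > 0"
proof -
  obtain p where "\<forall>z\<in>Z. rpoly_eval p z = h z"
    using polyfun_le_interpolation[OF assms(1), of h] by (auto simp: polyfun_le_def)
  then have "\<forall>z\<in>Z. h z * rpoly_eval p z > 0"
    using assms(2) by (auto simp: zero_less_mult_iff not_less_iff_gr_or_eq)
  then have "\<exists>d p. total_degree p = d \<and> (\<forall>z\<in>Z. h z * rpoly_eval p z > 0)" by blast
  from LeastI_ex[OF this] show ?thesis
    using that unfolding threshold_degree_def by blast
qed

text \<open>Gordan's alternative for the space of products \<open>f * q\<close> with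
  \<open>q\<close> of degree at most \<open>d\<close>: a positive member would sign-represent
  \<open>f\<close> in degree \<open>d\<close>, below its threshold degree.\<close>

lemma threshold_degree_dual_witness:
  assumes "finite X" "d < threshold_degree X f"
  obtains \<mu> where "\<And>x. x \<in> X \<Longrightarrow> \<mu> x \<ge> 0" "\<exists>x\<in>X. \<mu> x > 0"
    "\<And>q. q \<in> polyfun_le d \<Longrightarrow> (\<Sum>x\<in>X. \<mu> x * f x * q x) = 0"
proof -
  define V where "V = (\<lambda>q x. f x * q x) ` polyfun_le d"
  have "(\<exists>g\<in>V. \<forall>x\<in>X. g x > 0) \<or>
     (\<exists>\<mu>. (\<forall>x\<in>X. \<mu> x \<ge> 0) \<and> (\<exists>x\<in>X. \<mu> x > 0) \<and> (\<forall>g\<in>V. (\<Sum>x\<in>X. \<mu> x * g x) = 0))"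
  proof (rule gordan_alternative[OF assms(1)])
    show "(\<lambda>_. 0) \<in> V"
      unfolding V_def by (rule image_eqI[OF _ polyfun_le_const[of 0]]) simp
    fix g h c assume "g \<in> V" "h \<in> V"
    then obtain q r where qr: "q \<in> polyfun_le d" "r \<in> polyfun_le d"
      "g = (\<lambda>x. f x * q x)" "h = (\<lambda>x. f x * r x)" by (auto simp: V_def)
    show "(\<lambda>x. g x + c * h x) \<in> V"
      unfolding V_def
      by (rule image_eqI[OF _ polyfun_le_add[OF qr(1) polyfun_le_cmult[OF qr(2), of c]]])
         (simp add: qr algebra_simps)
  qed
  moreover have "\<not> (\<exists>g\<in>V. \<forall>x\<in>X. g x > 0)"
    using threshold_degree_le[of _ d X f] assms(2) by (fastforce simp: V_def)
  ultimately show ?thesis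
    using that by (auto simp: V_def mult.assoc)
qed

section \<open>Averaging over the blocks\<close>

text \<open>The inverse of \<open>block\<close>. It lets sums over the block power run over a
  function space, where \<open>prod_sum_PiE\<close> interchanges products and sums.\<close>

definition concat_blocks :: "('k::finite \<Rightarrow> real ^ 'n::finite) \<Rightarrow> real ^ ('k \<times> 'n)" where
  "concat_blocks g = (\<chi> ij. g (fst ij) $ snd ij)"

lemma block_concat_blocks [simp]: "block (concat_blocks g) i = g i"
  by (simp add: block_def concat_blocks_def vec_eq_iff)

lemma concat_blocks_block: "concat_blocks (block z) = z"
  by (simp add: block_def concat_blocks_def vec_eq_iff)

lemma block_power_eq_image: "block_power X = concat_blocks ` (\<Pi>\<^sub>E i\<in>UNIV. X)"
proof (intro equalityI subsetI)
  fix z assume "z \<in> block_power X"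
  then have "block z \<in> (\<Pi>\<^sub>E i\<in>UNIV. X)" by (auto simp: block_power_def)
  then show "z \<in> concat_blocks ` (\<Pi>\<^sub>E i\<in>UNIV. X)"
    by (intro image_eqI[of z _ "block z"]) (simp_all add: concat_blocks_block)
qed (auto simp: block_power_def PiE_iff)

lemma finite_block_power: "finite X \<Longrightarrow> finite (block_power X)"
  unfolding block_power_eq_image by (intro finite_imageI finite_PiE) auto

lemma monomial_eval_concat_blocks:
  "monomial_eval m (concat_blocks g) = (\<Prod>i\<in>UNIV. \<Prod>j\<in>UNIV. g i $ j ^ Poly_Mapping.lookup m (i, j))"
  unfolding monomial_eval_def UNIV_Times_UNIV[symmetric] concat_blocks_def
  by (simp add: prod.cartesian_product split_def)

lemma polyfun_le_power_product: "(\<lambda>x. \<Prod>j\<in>UNIV. x $ j ^ a j) \<in> polyfun_le (\<Sum>j\<in>UNIV. a j)"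
proof -
  have "(\<lambda>x. x $ j ^ n) \<in> polyfun_le n" for j :: 'a and n
    by (induction n) (use polyfun_le_const polyfun_le_mult[OF polyfun_le_component] in fastforce)+
  then show ?thesis by (intro polyfun_le_prod)
qed

text \<open>The average factors over the blocks into affine functions
  \<open>A i + B i * y $ i\<close>. Each nonconstant factor uses up at least \<open>d\<close> of the
  degree of \<open>m\<close>, so fewer than \<open>D\<close> factors are nonconstant.\<close>

lemma averaged_monomial_polyfun_le:
  fixes X :: "(real ^ 'n::finite) set" and m :: "('k::finite \<times> 'n) \<Rightarrow>\<^sub>0 nat"
  assumes "finite X" "d > 0" "monomial_degree m < D * d"
    and orth: "\<And>q. q \<in> polyfun_le (d - 1) \<Longrightarrow> (\<Sum>x\<in>X. \<mu> x * f x * q x) = 0"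
  shows "(\<lambda>y. \<Sum>g\<in>(\<Pi>\<^sub>E i\<in>UNIV. X). (\<Prod>i\<in>UNIV. \<mu> (g i) * (1 + y $ i * f (g i))) *
            monomial_eval m (concat_blocks g)) \<in> polyfun_le (D - 1)"
proof -
  define q where "q i x = (\<Prod>j\<in>UNIV. x $ j ^ Poly_Mapping.lookup m (i, j))" for i and x :: "real ^ 'n"
  define \<delta> where "\<delta> i = (\<Sum>j\<in>UNIV. Poly_Mapping.lookup m (i, j))" for i
  define A where "A i = (\<Sum>x\<in>X. \<mu> x * q i x)" for i
  define B where "B i = (\<Sum>x\<in>X. \<mu> x * f x * q i x)" for i
  define e where "e i = (if \<delta> i < d then 0 else 1 :: nat)" for i
  have "(\<Sum>g\<in>(\<Pi>\<^sub>E i\<in>UNIV. X). (\<Prod>i\<in>UNIV. \<mu> (g i) * (1 + y $ i * f (g i))) *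
            monomial_eval m (concat_blocks g)) = (\<Prod>i\<in>UNIV. A i + B i * y $ i)" for y :: "real ^ 'k"
  proof -
    have "(\<Prod>i\<in>UNIV. A i + B i * y $ i)
        = (\<Prod>i\<in>UNIV. \<Sum>x\<in>X. \<mu> x * (1 + y $ i * f x) * q i x)"
      unfolding A_def B_def sum_distrib_right sum.distrib[symmetric]
      by (simp add: distrib_left distrib_right mult_ac)
    also have "\<dots> = (\<Sum>g\<in>(\<Pi>\<^sub>E i\<in>UNIV. X). \<Prod>i\<in>UNIV. \<mu> (g i) * (1 + y $ i * f (g i)) * q i (g i))"
      using assms(1) by (intro prod_sum_PiE) auto
    also have "\<dots> = (\<Sum>g\<in>(\<Pi>\<^sub>E i\<in>UNIV. X). (\<Prod>i\<in>UNIV. \<mu> (g i) * (1 + y $ i * f (g i))) *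
            monomial_eval m (concat_blocks g))"
      by (simp only: monomial_eval_concat_blocks prod.distrib q_def)
    finally show ?thesis by simp
  qed
  moreover have "(\<lambda>y. \<Prod>i\<in>UNIV. A i + B i * y $ i) \<in> polyfun_le (\<Sum>i\<in>UNIV. e i)"
  proof (intro polyfun_le_prod)
    fix i :: 'k
    show "(\<lambda>y. A i + B i * y $ i) \<in> polyfun_le (e i)"
    proof (cases "\<delta> i < d")
      case True
      have "q i \<in> polyfun_le (\<delta> i)"
        unfolding q_def \<delta>_def by (rule polyfun_le_power_product)
      then have "B i = 0"
        \<comment> \<open>\<open>\<delta> i < d\<close> means degree at most \<open>d - 1\<close>,
          where orthogonality applies.\<close>
        unfolding B_def using True by (intro orth subsetD[OF polyfun_le_mono[of "\<delta> i" "d - 1"]]) auto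
      then show ?thesis by (simp add: polyfun_le_const)
    next
      case False
      then have "e i = 1" by (simp add: e_def)
      then show ?thesis
        using polyfun_le_add[OF polyfun_le_const polyfun_le_cmult[OF polyfun_le_component]] by simp
    qed
  qed
  moreover have "(\<Sum>i\<in>UNIV. e i) \<le> D - 1"
  proof -
    have "(\<Sum>i\<in>UNIV. e i) * d = (\<Sum>i\<in>UNIV. e i * d)" by (rule sum_distrib_right)
    also have "\<dots> \<le> (\<Sum>i\<in>UNIV. \<delta> i)" by (intro sum_mono) (auto simp: e_def)
    also have "\<dots> = monomial_degree m"
      unfolding monomial_degree_def \<delta>_def UNIV_Times_UNIV[symmetric]
      by (simp add: sum.cartesian_product)
    also have "\<dots> < D * d" by (rule assms(3))
    \<comment> \<open>Cancelling \<open>d\<close> leaves a strict inequality, hence the bound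
      \<open>D - 1\<close>.\<close>
    finally show ?thesis by auto
  qed
  ultimately show ?thesis using polyfun_le_mono by auto
qed

text \<open>Every tuple of nonzero weight satisfies \<open>f (g i) = y $ i\<close> for all
  \<open>i\<close>, so there the composition takes the value \<open>F y\<close>. All terms of the
  average thus agree in sign with \<open>F y\<close> or vanish, and at least one does not
  vanish.\<close>

lemma averaged_sign:
  fixes X :: "(real ^ 'n::finite) set" and F :: "real ^ 'k::finite \<Rightarrow> real"
  assumes "finite X" "f ` X \<subseteq> {-1, 1}" "y \<in> sign_cube"
    and \<mu>: "\<And>x. x \<in> X \<Longrightarrow> \<mu> x \<ge> 0" "\<exists>x\<in>X. \<mu> x > 0" "(\<Sum>x\<in>X. \<mu> x * f x) = 0"
    and pos: "\<And>z. z \<in> block_power X \<Longrightarrow> block_compose F f z * p z > 0"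
  shows "F y * (\<Sum>g\<in>(\<Pi>\<^sub>E i\<in>UNIV. X). (\<Prod>i\<in>UNIV. \<mu> (g i) * (1 + y $ i * f (g i))) *
            p (concat_blocks g)) > 0"
proof -
  define w where "w i x = \<mu> x * (1 + y $ i * f x)" for i x
  have y: "y $ i = -1 \<or> y $ i = 1" for i using assms(3) by (auto simp: sign_cube_def)
  have f: "f x = -1 \<or> f x = 1" if "x \<in> X" for x using assms(2) that by auto
  have w_nonneg: "w i x \<ge> 0" if "x \<in> X" for i x
    using \<mu>(1)[OF that] f[OF that] y[of i] by (auto simp: w_def)
  \<comment> \<open>Since \<open>f\<close> has mean zero under \<open>\<mu>\<close>, the weights
    \<open>w i\<close> have the same positive total as \<open>\<mu>\<close>, whichever sign
    \<open>y $ i\<close> is.\<close>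
  have "\<exists>x\<in>X. w i x > 0" for i
  proof (rule ccontr)
    assume "\<not> (\<exists>x\<in>X. w i x > 0)"
    then have "(\<Sum>x\<in>X. w i x) \<le> 0" by (intro sum_nonpos) (auto simp: not_less)
    moreover have "(\<Sum>x\<in>X. w i x) = (\<Sum>x\<in>X. \<mu> x) + y $ i * (\<Sum>x\<in>X. \<mu> x * f x)"
      by (simp add: w_def algebra_simps sum.distrib sum_distrib_left)
    moreover obtain x where "x \<in> X" "\<mu> x > 0" using \<mu>(2) by blast
    then have "(\<Sum>x\<in>X. \<mu> x) > 0" using assms(1) \<mu>(1) by (intro sum_pos2[of _ x]) auto
    ultimately show False using \<mu>(3) by simp
  qed
  then obtain g0 where g0: "g0 i \<in> X" "w i (g0 i) > 0" for i by metis
  \<comment> \<open>The factor \<open>1 + y $ i * f x\<close> is 2 when the signs agree and 0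
    otherwise.\<close>
  have sgn: "f x = y $ i" if "w i x \<noteq> 0" "x \<in> X" for i x
    using that f[of x] y[of i] by (auto simp: w_def)
  have Fp: "F y * p (concat_blocks g) > 0" if "\<And>i. g i \<in> X" "\<And>i. w i (g i) \<noteq> 0" for g
  proof -
    have "(\<chi> i. f (block (concat_blocks g) i)) = y" using sgn that by (simp add: vec_eq_iff)
    moreover have "concat_blocks g \<in> block_power X" using that by (simp add: block_power_def)
    ultimately show ?thesis using pos[of "concat_blocks g"] by (simp add: block_compose_def)
  qed
  have "(\<Sum>g\<in>(\<Pi>\<^sub>E i\<in>UNIV. X). (\<Prod>i\<in>UNIV. w i (g i)) * (F y * p (concat_blocks g))) > 0"
  proof (rule sum_pos2[of _ g0])
    show "finite (\<Pi>\<^sub>E i\<in>(UNIV::'k set). X)" using assms(1) by (intro finite_PiE) auto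
    show "g0 \<in> (\<Pi>\<^sub>E i\<in>UNIV. X)" using g0 by auto
    show "(\<Prod>i\<in>UNIV. w i (g0 i)) * (F y * p (concat_blocks g0)) > 0"
    proof (intro mult_pos_pos[OF prod_pos Fp])
      show "w i (g0 i) \<noteq> 0" for i using g0(2)[of i] by simp
    qed (use g0 in auto)
    fix g assume g: "g \<in> (\<Pi>\<^sub>E i\<in>(UNIV::'k set). X)"
    show "(\<Prod>i\<in>UNIV. w i (g i)) * (F y * p (concat_blocks g)) \<ge> 0"
    proof (cases "\<exists>i. w i (g i) = 0")
      case True
      then have "(\<Prod>i\<in>UNIV. w i (g i)) = 0" by (intro prod_zero) auto
      then show ?thesis by (simp only: mult_zero_left order_refl)
    next
      case False
      have "F y * p (concat_blocks g) > 0" using g False by (intro Fp) (auto simp: PiE_iff)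
      moreover have "(\<Prod>i\<in>UNIV. w i (g i)) \<ge> 0"
        using g w_nonneg by (intro prod_nonneg) (auto simp: PiE_iff)
      ultimately show ?thesis by simp
    qed
  qed
  then show ?thesis by (simp add: w_def sum_distrib_left algebra_simps)
qed

theorem theorem1p1:
  fixes X :: "(real ^ 'n::finite) set"
    and f :: "real ^ 'n \<Rightarrow> real"
    and F :: "real ^ 'k::finite \<Rightarrow> real"
  assumes "finite X"
    and "f ` X \<subseteq> {-1, 1}"
    and "F ` sign_cube \<subseteq> {-1, 1}"
  shows "threshold_degree (block_power X) (block_compose F f)
           \<ge> threshold_degree sign_cube F * threshold_degree X f"
proof (rule ccontr)
  let ?d = "threshold_degree X f" and ?D = "threshold_degree sign_cube F"
  assume "\<not> ?thesis"
  then have less: "threshold_degree (block_power X) (block_compose F f) < ?D * ?d" by simp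
  \<comment> \<open>A product exceeding a natural number has no zero factor, so both later
    subtractions of 1 are genuine.\<close>
  then have dD: "?d > 0" "?D > 0" by (auto intro: Nat.gr0I)
  have "block_compose F f z \<noteq> 0" if "z \<in> block_power X" for z
  proof -
    have "(\<chi> i. f (block z i)) \<in> sign_cube"
      using that assms(2) by (auto simp: sign_cube_def block_power_def)
    then show ?thesis using assms(3) by (force simp: block_compose_def)
  qed
  then obtain p where p: "total_degree p = threshold_degree (block_power X) (block_compose F f)"
    "\<And>z. z \<in> block_power X \<Longrightarrow> block_compose F f z * rpoly_eval p z > 0"
    using threshold_degree_attained[OF finite_block_power[OF assms(1)]] by metis
  obtain \<mu> where \<mu>: "\<And>x. x \<in> X \<Longrightarrow> \<mu> x \<ge> 0" "\<exists>x\<in>X. \<mu> x > 0"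
    "\<And>q. q \<in> polyfun_le (?d - 1) \<Longrightarrow> (\<Sum>x\<in>X. \<mu> x * f x * q x) = 0"
    using threshold_degree_dual_witness[OF assms(1), of "?d - 1" f] dD by auto
  \<comment> \<open>Constants have degree at most \<open>?d - 1\<close>, so the two sign classes of
    \<open>f\<close> carry equal weight.\<close>
  have bal: "(\<Sum>x\<in>X. \<mu> x * f x) = 0" using \<mu>(3)[OF polyfun_le_const[of 1]] by simp
  define W where "W y g = (\<Prod>i\<in>UNIV. \<mu> (g i) * (1 + y $ i * f (g i)))" for y :: "real ^ 'k" and g
  define P where "P y = (\<Sum>g\<in>(\<Pi>\<^sub>E i\<in>UNIV. X). W y g * rpoly_eval p (concat_blocks g))" for y
  \<comment> \<open>Averaging is linear in the polynomial, so the degree can be bounded one monomial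
    at a time.\<close>
  have "P y = (\<Sum>m\<in>Poly_Mapping.keys p. Poly_Mapping.lookup p m *
      (\<Sum>g\<in>(\<Pi>\<^sub>E i\<in>UNIV. X). W y g * monomial_eval m (concat_blocks g)))" for y
    unfolding P_def rpoly_eval_def monomial_eval_def[symmetric] sum_distrib_left
    by (subst sum.swap) (simp add: algebra_simps)
  moreover have "(\<lambda>y. \<Sum>m\<in>Poly_Mapping.keys p. Poly_Mapping.lookup p m *
      (\<Sum>g\<in>(\<Pi>\<^sub>E i\<in>UNIV. X). W y g * monomial_eval m (concat_blocks g))) \<in> polyfun_le (?D - 1)"
    unfolding W_def
  proof (rule polyfun_le_sum, rule polyfun_le_cmult,
      rule averaged_monomial_polyfun_le[OF assms(1) dD(1)])
    fix m assume "m \<in> Poly_Mapping.keys p"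
    then have "monomial_degree m \<le> total_degree p" using total_degree_le_iff by blast
    then show "monomial_degree m < ?D * ?d" using less p(1) by simp
  qed (rule \<mu>(3))
  ultimately have "P \<in> polyfun_le (?D - 1)" by presburger
  \<comment> \<open>\<open>P\<close> would sign-represent \<open>F\<close> in a degree below its
    threshold degree.\<close>
  then have "?D \<le> ?D - 1"
  proof (rule threshold_degree_le)
    fix y :: "real ^ 'k" assume y: "y \<in> sign_cube"
    show "F y * P y > 0"
      unfolding P_def W_def using averaged_sign[OF assms(1,2) y \<mu>(1,2) bal p(2)] by blast
  qed
  then show False using dD by simp
qed

end
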